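(* Let $H$ be a unitary, projective, positive energy representation of the Witt superalgebra $\mathfrak W_{1/2}$. Then: (a) any non-zero vector $v$ in the lowest energy subspace $H_0$ generates an irreducible submodule; (b) $H$ is an orthogonal direct sum of irreducible unitary, projective, positive energy representations of $\mathfrak W_{1/2}$.
   Context: $\mathfrak W_{1/2}$ is the complex Lie superalgebra with even part $\bigoplus_{n\in\mathbb Z}\mathbb C d_n$, odd part $\bigoplus_{m\in\mathbb Z+1/2}\mathbb C\gamma_m$, brackets $[d_m,d_n]=(m-n)d_{m+n}$, $[\gamma_m,d_n]=(m-\frac n2)\gamma_{m+n}$, $[\gamma_m,\gamma_n]_+=2d_{m+n}$, and $\star$-structure $d_n^\star=d_{-n}$, $\gamma_m^\star=\gamma_{-m}$. Let $H$ be a prehilbert space (complex inner product space, not necessarily complete) and $\pi:\mathfrak W_{1/2}\to \mathrm{End}(H)$. The representation is: unitary if $\pi(A)^\star=\pi(A^\star)$; projective if $\pi$ is linear and $[\pi(A),\pi(B)]-\pi([A,B])\in\mathbb C\cdot I$ for homogeneous $A,B$ (graded bracket: anticommutator if both are odd, commutator otherwise); positive energy if $H$ has an orthogonal (algebraic) decomposition $H=\bigoplus_{n\in\frac12\mathbb N}H_n$ and there is $D$ acting on $H_n$ as multiplication by $n$, with $H_0\neq\{0\}$, $\dim H_n<\infty$, and $D=\pi(d_0)-hI$ for some $h\in\mathbb C$. $H_0$ is called the lowest energy subspace. *)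

theory Defs
  imports Complex_Main "HOL-Library.Poly_Mapping"
begin

section \<open>The Witt superalgebra\<close>

text \<open>
  The basis: \<open>Dgen n\<close> is \<open>d\<^sub>n\<close> and \<open>Ggen k\<close> is the odd generator
  \<open>\<gamma>\<^sub>m\<close> with the half-integer index \<open>m = k + 1/2\<close>.
\<close>

datatype witt_gen = Dgen int | Ggen int

type_synonym witt = "witt_gen \<Rightarrow>\<^sub>0 complex"

definition witt_scale :: "complex \<Rightarrow> witt \<Rightarrow> witt" where
  "witt_scale c A = Poly_Mapping.map ((*) c) A"

definition witt_even :: "witt \<Rightarrow> bool" where
  "witt_even A \<longleftrightarrow> Poly_Mapping.keys A \<subseteq> range Dgen"

definition witt_odd :: "witt \<Rightarrow> bool" where
  "witt_odd A \<longleftrightarrow> Poly_Mapping.keys A \<subseteq> range Ggen"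

text \<open>
  With \<open>m = j + 1/2\<close> and \<open>m' = k + 1/2\<close> one has \<open>m + m' = j + k + 1\<close>. The third
  equation is forced by the second and graded antisymmetry.
\<close>

fun witt_bracket_gen :: "witt_gen \<Rightarrow> witt_gen \<Rightarrow> witt" where
  "witt_bracket_gen (Dgen m) (Dgen n) = Poly_Mapping.single (Dgen (m + n)) (of_int (m - n))"
| "witt_bracket_gen (Ggen k) (Dgen n) =
     Poly_Mapping.single (Ggen (k + n)) ((of_int k + 1/2) - of_int n / 2)"
| "witt_bracket_gen (Dgen n) (Ggen k) =
     - Poly_Mapping.single (Ggen (k + n)) ((of_int k + 1/2) - of_int n / 2)"
| "witt_bracket_gen (Ggen j) (Ggen k) = Poly_Mapping.single (Dgen (j + k + 1)) 2"

definition witt_bracket :: "witt \<Rightarrow> witt \<Rightarrow> witt" where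
  "witt_bracket A B =
     (\<Sum>a\<in>Poly_Mapping.keys A. \<Sum>b\<in>Poly_Mapping.keys B.
        witt_scale (Poly_Mapping.lookup A a * Poly_Mapping.lookup B b) (witt_bracket_gen a b))"

text \<open>For \<open>m = k + 1/2\<close>, \<open>-m = (-k - 1) + 1/2\<close>. The star is extended antilinearly.\<close>

fun witt_star_gen :: "witt_gen \<Rightarrow> witt_gen" where
  "witt_star_gen (Dgen n) = Dgen (- n)"
| "witt_star_gen (Ggen k) = Ggen (- k - 1)"

definition witt_star :: "witt \<Rightarrow> witt" where
  "witt_star A =
     (\<Sum>a\<in>Poly_Mapping.keys A. Poly_Mapping.single (witt_star_gen a) (cnj (Poly_Mapping.lookup A a)))"

section \<open>Prehilbert spaces\<close>

class prehilbert = ab_group_add +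
  fixes scaleC :: "complex \<Rightarrow> 'a \<Rightarrow> 'a" (infixr \<open>*\<^sub>C\<close> 75)
    and cinner :: "'a \<Rightarrow> 'a \<Rightarrow> complex"
  assumes scaleC_add_right: "c *\<^sub>C (x + y) = c *\<^sub>C x + c *\<^sub>C y"
    and scaleC_add_left: "(b + c) *\<^sub>C x = b *\<^sub>C x + c *\<^sub>C x"
    and scaleC_scaleC: "b *\<^sub>C (c *\<^sub>C x) = (b * c) *\<^sub>C x"
    and scaleC_one: "1 *\<^sub>C x = x"
    and cinner_add_left: "cinner (x + y) z = cinner x z + cinner y z"
    and cinner_scaleC_left: "cinner (c *\<^sub>C x) y = c * cinner x y"
    and cinner_commute: "cinner x y = cnj (cinner y x)"
    and cinner_ge_zero: "0 \<le> Re (cinner x x)"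
    and cinner_eq_zero_iff: "cinner x x = 0 \<longleftrightarrow> x = 0"

global_interpretation cvec: vector_space "scaleC :: complex \<Rightarrow> 'a \<Rightarrow> 'a::prehilbert"
  by standard (simp_all add: scaleC_add_right scaleC_add_left scaleC_scaleC scaleC_one)

text \<open>
  Spaces and their subrepresentations are treated uniformly as complex subspaces of an ambient
  prehilbert type; a whole prehilbert space is \<open>UNIV\<close>. Operators are functions on the ambient
  type, of which only the values on the given subspace matter.
\<close>

definition operator_on :: "'h::prehilbert set \<Rightarrow> ('h \<Rightarrow> 'h) \<Rightarrow> bool" where
  "operator_on H T \<longleftrightarrow>
     (\<forall>x\<in>H. T x \<in> H) \<and>
     (\<forall>x\<in>H. \<forall>y\<in>H. T (x + y) = T x + T y) \<and>
     (\<forall>c. \<forall>x\<in>H. T (c *\<^sub>C x) = c *\<^sub>C T x)"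

text \<open>The sum is algebraic; it is direct because the summands are pairwise orthogonal.\<close>

definition orthogonal_direct_sum :: "'i set \<Rightarrow> ('i \<Rightarrow> 'h::prehilbert set) \<Rightarrow> 'h set \<Rightarrow> bool" where
  "orthogonal_direct_sum I V H \<longleftrightarrow>
     (\<forall>i\<in>I. cvec.subspace (V i)) \<and>
     (\<forall>i\<in>I. \<forall>j\<in>I. i \<noteq> j \<longrightarrow> (\<forall>x\<in>V i. \<forall>y\<in>V j. cinner x y = 0)) \<and>
     H = cvec.span (\<Union>i\<in>I. V i)"

section \<open>Representations\<close>

text \<open>\<open>\<pi>\<close> is a map from the superalgebra to \<open>End(H)\<close>.\<close>

definition witt_action :: "'h::prehilbert set \<Rightarrow> (witt \<Rightarrow> 'h \<Rightarrow> 'h) \<Rightarrow> bool" where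
  "witt_action H \<pi> \<longleftrightarrow> cvec.subspace H \<and> (\<forall>A. operator_on H (\<pi> A))"

definition unitary_rep :: "'h::prehilbert set \<Rightarrow> (witt \<Rightarrow> 'h \<Rightarrow> 'h) \<Rightarrow> bool" where
  "unitary_rep H \<pi> \<longleftrightarrow>
     (\<forall>A. \<forall>x\<in>H. \<forall>y\<in>H. cinner (\<pi> A x) y = cinner x (\<pi> (witt_star A) y))"

definition projective_rep :: "'h::prehilbert set \<Rightarrow> (witt \<Rightarrow> 'h \<Rightarrow> 'h) \<Rightarrow> bool" where
  "projective_rep H \<pi> \<longleftrightarrow>
     (\<forall>A B. \<forall>x\<in>H. \<pi> (A + B) x = \<pi> A x + \<pi> B x) \<and>
     (\<forall>c A. \<forall>x\<in>H. \<pi> (witt_scale c A) x = c *\<^sub>C \<pi> A x) \<and>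
     (\<forall>A B. (witt_even A \<or> witt_odd A) \<and> (witt_even B \<or> witt_odd B) \<longrightarrow>
        (\<exists>c. \<forall>x\<in>H.
           (if witt_odd A \<and> witt_odd B
            then \<pi> A (\<pi> B x) + \<pi> B (\<pi> A x)
            else \<pi> A (\<pi> B x) - \<pi> B (\<pi> A x)) - \<pi> (witt_bracket A B) x = c *\<^sub>C x))"

text \<open>\<open>V k\<close> is the summand \<open>H\<^sub>n\<close> of energy \<open>n = k/2\<close>; \<open>V 0\<close> is the lowest energy subspace.\<close>

definition energy_decomposition ::
  "'h::prehilbert set \<Rightarrow> (witt \<Rightarrow> 'h \<Rightarrow> 'h) \<Rightarrow> (nat \<Rightarrow> 'h set) \<Rightarrow> bool" where
  "energy_decomposition H \<pi> V \<longleftrightarrow>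
     orthogonal_direct_sum UNIV V H \<and>
     V 0 \<noteq> {0} \<and>
     (\<forall>k. \<exists>B. finite B \<and> V k = cvec.span B) \<and>
     (\<exists>D. operator_on H D \<and>
        (\<forall>k. \<forall>x\<in>V k. D x = (of_nat k / 2) *\<^sub>C x) \<and>
        (\<exists>h. \<forall>x\<in>H. D x = \<pi> (Poly_Mapping.single (Dgen 0) 1) x - h *\<^sub>C x))"

definition positive_energy_rep :: "'h::prehilbert set \<Rightarrow> (witt \<Rightarrow> 'h \<Rightarrow> 'h) \<Rightarrow> bool" where
  "positive_energy_rep H \<pi> \<longleftrightarrow> (\<exists>V. energy_decomposition H \<pi> V)"

definition submodule :: "'h::prehilbert set \<Rightarrow> (witt \<Rightarrow> 'h \<Rightarrow> 'h) \<Rightarrow> 'h set \<Rightarrow> bool" where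
  "submodule H \<pi> K \<longleftrightarrow> cvec.subspace K \<and> K \<subseteq> H \<and> (\<forall>A. \<forall>x\<in>K. \<pi> A x \<in> K)"

definition generated_submodule ::
  "'h::prehilbert set \<Rightarrow> (witt \<Rightarrow> 'h \<Rightarrow> 'h) \<Rightarrow> 'h \<Rightarrow> 'h set" where
  "generated_submodule H \<pi> v = \<Inter>{K. submodule H \<pi> K \<and> v \<in> K}"

definition irreducible_rep :: "'h::prehilbert set \<Rightarrow> (witt \<Rightarrow> 'h \<Rightarrow> 'h) \<Rightarrow> bool" where
  "irreducible_rep H \<pi> \<longleftrightarrow>
     witt_action H \<pi> \<and> H \<noteq> {0} \<and> (\<forall>K. submodule H \<pi> K \<longrightarrow> K = {0} \<or> K = H)"

end

(*
  Up to scalars every generator is homogeneous for the energy grading. Commuting generators to the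
  right shows that a lowest vector v generates the span of the words of raising generators applied
  to v, so its lowest energy space is the line through v. A submodule K of the module generated
  by v is graded; if K is not orthogonal to v it therefore contains v, and if it is orthogonal
  to v, unitarity makes it orthogonal to itself. For the decomposition, take a maximal orthogonal
  family of irreducible submodules: since the energy spaces are finite-dimensional, its span has an
  orthogonal complement, in which a lowest vector would generate a further irreducible submodule.
*)

theory Submission
  imports Defs
begin

section \<open>Prehilbert spaces\<close>

lemma cinner_zero_left [simp]: "cinner 0 x = (0::complex)"
  using cinner_scaleC_left[of 0 0 x] by simp

lemma cinner_zero_right [simp]: "cinner x 0 = (0::complex)"
  by (subst cinner_commute) simp

lemma cinner_add_right: "cinner x (y + z) = cinner x y + cinner x z"
  by (metis cinner_add_left cinner_commute complex_cnj_add)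

lemma cinner_scaleC_right: "cinner x (c *\<^sub>C y) = cnj c * cinner x y"
  by (metis cinner_scaleC_left cinner_commute complex_cnj_mult)

lemma cinner_minus_left: "cinner (- x) y = - cinner x y"
  using cinner_add_left[of "- x" x y] by (simp add: eq_neg_iff_add_eq_0)

lemma cinner_diff_left: "cinner (x - y) z = cinner x z - cinner y z"
  by (simp only: diff_conv_add_uminus cinner_add_left cinner_minus_left)

lemma cinner_eq_0_sym: "cinner x y = 0 \<longleftrightarrow> cinner y x = 0"
  by (metis cinner_commute complex_cnj_zero)

lemma subspace_orthogonal_left: "cvec.subspace {x. cinner x y = 0}"
  by (auto simp: cvec.subspace_def cinner_add_left cinner_scaleC_left)

lemma subspace_orthogonal_right: "cvec.subspace {y. cinner x y = 0}"
  by (auto simp: cvec.subspace_def cinner_add_right cinner_scaleC_right)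

lemma orthogonal_span_right:
  assumes "\<And>y. y \<in> S \<Longrightarrow> cinner x y = 0" and "y \<in> cvec.span S"
  shows "cinner x y = 0"
  using cvec.span_minimal[OF _ subspace_orthogonal_right, of S x] assms by blast

text \<open>Gram-Schmidt, one vector of \<open>B\<close> at a time: the new vector \<open>b\<close>
  minus its projection to the old span gives one further orthogonal direction. Finite dimension
  takes the place of completeness.\<close>

lemma finite_span_projection:
  assumes "finite B"
  shows "\<exists>p\<in>cvec.span B. \<forall>y\<in>cvec.span B. cinner (x - p) y = 0"
  using assms
proof (induction B arbitrary: x rule: finite_induct)
  case empty
  then show ?case by simp
next
  case (insert b B)
  obtain q where q: "q \<in> cvec.span B" "\<And>y. y \<in> cvec.span B \<Longrightarrow> cinner (b - q) y = 0"
    using insert.IH[of b] by blast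
  obtain r where r: "r \<in> cvec.span B" "\<And>y. y \<in> cvec.span B \<Longrightarrow> cinner (x - r) y = 0"
    using insert.IH[of x] by blast
  define e where "e = b - q"
  \<comment> \<open>The coefficient makes \<open>x - p\<close> orthogonal to \<open>e\<close>. If
    \<open>e = 0\<close>, the added term vanishes and orthogonality to \<open>e\<close> is
    trivial.\<close>
  define p where "p = r + (cinner (x - r) e / cinner e e) *\<^sub>C e"
  have sub: "cvec.span B \<subseteq> cvec.span (insert b B)"
    by (rule cvec.span_mono) blast
  have e_in: "e \<in> cvec.span (insert b B)"
    unfolding e_def using subsetD[OF sub q(1)] by (simp add: cvec.span_diff cvec.span_base)
  have p_in: "p \<in> cvec.span (insert b B)"
    unfolding p_def by (rule cvec.span_add[OF subsetD[OF sub r(1)] cvec.span_scale[OF e_in]])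
  have eB: "cinner e y = 0" if "y \<in> cvec.span B" for y
    using q(2) that by (simp add: e_def)
  have pB: "cinner (x - p) y = 0" if "y \<in> cvec.span B" for y
    using r(2)[OF that] eB[OF that]
    by (simp add: p_def cinner_diff_left cinner_add_left cinner_scaleC_left)
  have pe: "cinner (x - p) e = 0"
    by (cases "e = 0")
      (simp_all add: p_def cinner_diff_left cinner_add_left cinner_scaleC_left cinner_eq_zero_iff)
  have "cinner (x - p) b = 0"
    using pe pB[OF q(1)] cinner_add_right[of "x - p" e q] by (simp add: e_def)
  then have "cinner (x - p) y = 0" if "y \<in> cvec.span (insert b B)" for y
    using pB cvec.span_base by (intro orthogonal_span_right[OF _ that]) blast
  with p_in show ?case by blast
qed

text \<open>Independent subsets of the span of a finite set are finite, so a maximal independent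
  subset of \<open>S\<close> is a finite spanning set.\<close>

lemma subspace_of_finite_span:
  assumes "cvec.subspace S" and "S \<subseteq> cvec.span B" and "finite B"
  shows "\<exists>C. finite C \<and> S = cvec.span C"
proof -
  obtain C where C: "C \<subseteq> S" "cvec.independent C" "S \<subseteq> cvec.span C"
    by (rule cvec.maximal_independent_subset)
  have "finite C"
    using cvec.independent_span_bound[OF assms(3) C(2)] C(1) assms(2) by blast
  moreover have "cvec.span C \<subseteq> S"
    by (rule cvec.span_minimal[OF C(1) assms(1)])
  ultimately show ?thesis using C(3) by blast
qed

section \<open>Submodules\<close>

lemma submodule_trans: "submodule H \<pi> K \<Longrightarrow> submodule K \<pi> L \<Longrightarrow> submodule H \<pi> L"
  unfolding submodule_def by blast

lemma submodule_witt_action: "witt_action H \<pi> \<Longrightarrow> submodule H \<pi> K \<Longrightarrow> witt_action K \<pi>"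
  unfolding witt_action_def submodule_def operator_on_def by blast

lemma submodule_unitary_rep: "unitary_rep H \<pi> \<Longrightarrow> submodule H \<pi> K \<Longrightarrow> unitary_rep K \<pi>"
  unfolding unitary_rep_def submodule_def by blast

lemma submodule_projective_rep:
  assumes "projective_rep H \<pi>" and "submodule H \<pi> K"
  shows "projective_rep K \<pi>"
proof -
  have "K \<subseteq> H" using assms(2) by (simp add: submodule_def)
  with assms(1) show ?thesis
    unfolding projective_rep_def by (meson subsetD)
qed

lemma submodule_self: "witt_action H \<pi> \<Longrightarrow> submodule H \<pi> H"
  unfolding submodule_def witt_action_def operator_on_def by blast

lemma submodule_generated:
  assumes "witt_action H \<pi>" and "v \<in> H"
  shows "submodule H \<pi> (generated_submodule H \<pi> v)"
proof -
  have "generated_submodule H \<pi> v \<subseteq> H"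
    unfolding generated_submodule_def using submodule_self[OF assms(1)] assms(2) by blast
  moreover have "cvec.subspace (generated_submodule H \<pi> v)"
    unfolding generated_submodule_def by (intro cvec.subspace_Inter) (auto simp: submodule_def)
  moreover have "\<forall>A. \<forall>x\<in>generated_submodule H \<pi> v. \<pi> A x \<in> generated_submodule H \<pi> v"
    unfolding generated_submodule_def submodule_def by blast
  ultimately show ?thesis unfolding submodule_def by blast
qed

lemma generated_submodule_base: "v \<in> generated_submodule H \<pi> v"
  unfolding generated_submodule_def by blast

lemma generated_submodule_minimal:
  "submodule H \<pi> K \<Longrightarrow> v \<in> K \<Longrightarrow> generated_submodule H \<pi> v \<subseteq> K"
  unfolding generated_submodule_def by blast

section \<open>Graded representations\<close>

definition gen :: "witt_gen \<Rightarrow> witt" where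
  "gen g = Poly_Mapping.single g 1"

text \<open>Twice the index of a generator; it is the number of half-integer steps by which the
  generator lowers the energy.\<close>

fun gen_deg :: "witt_gen \<Rightarrow> int" where
  "gen_deg (Dgen n) = 2 * n"
| "gen_deg (Ggen k) = 2 * k + 1"

lemma witt_scale_single: "witt_scale c (Poly_Mapping.single g a) = Poly_Mapping.single g (c * a)"
  by (rule poly_mapping_eqI) (simp add: witt_scale_def map.rep_eq lookup_single when_def)

lemma gen_homogeneous: "witt_even (gen g) \<or> witt_odd (gen g)"
  by (cases g) (auto simp: gen_def witt_even_def witt_odd_def)

lemma gen_Dgen_not_odd: "\<not> witt_odd (gen (Dgen n))"
  by (auto simp: gen_def witt_odd_def)

text \<open>Since \<open>gen_deg g / 2\<close> is the index \<open>m\<close> of the generator, this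
  is \<open>[d_0, x_m] = - m x_m\<close> for both kinds of generators. It is the reason why a
  generator moves the energy by a fixed amount.\<close>

lemma bracket_d0_gen:
  "witt_bracket (gen (Dgen 0)) (gen g) = witt_scale (- of_int (gen_deg g) / 2) (gen g)"
proof (cases g)
  case (Dgen n)
  then show ?thesis by (simp add: gen_def witt_bracket_def witt_scale_single)
next
  case (Ggen k)
  have "- ((of_int k :: complex) + 1 / 2) = - of_int (2 * k + 1) / 2" by (simp add: field_simps)
  then have "- Poly_Mapping.single (Ggen k) ((of_int k :: complex) + 1 / 2)
      = Poly_Mapping.single (Ggen k) (- of_int (2 * k + 1) / 2)"
    by (simp only: single_uminus[symmetric])
  then show ?thesis
    using Ggen by (simp add: gen_def witt_bracket_def witt_scale_single)
qed

text \<open>An energy decomposition with its operator \<open>D\<close> and its constant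
  \<open>h\<close> fixed. As a locale it can be instantiated again for a nonzero submodule with a
  grading of its own.\<close>

locale graded_witt_rep =
  fixes H :: "'h::prehilbert set" and \<pi> :: "witt \<Rightarrow> 'h \<Rightarrow> 'h"
    and V :: "nat \<Rightarrow> 'h set" and D :: "'h \<Rightarrow> 'h" and h :: complex
  assumes action: "witt_action H \<pi>"
    and unitary: "unitary_rep H \<pi>"
    and projective: "projective_rep H \<pi>"
    and sum_V: "orthogonal_direct_sum UNIV V H"
    and V_finite: "\<And>k. \<exists>B. finite B \<and> V k = cvec.span B"
    and D_operator: "operator_on H D"
    and D_V: "\<And>k x. x \<in> V k \<Longrightarrow> D x = (of_nat k / 2) *\<^sub>C x"
    and D_eq: "\<And>x. x \<in> H \<Longrightarrow> D x = \<pi> (gen (Dgen 0)) x - h *\<^sub>C x"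
begin

section \<open>Linearity of the action and exchange of two elements\<close>

lemma subspace_H: "cvec.subspace H"
  using action by (simp add: witt_action_def)

lemma subspace_V: "cvec.subspace (V k)"
  using sum_V by (simp add: orthogonal_direct_sum_def)

lemma V_orthogonal: "x \<in> V i \<Longrightarrow> y \<in> V j \<Longrightarrow> i \<noteq> j \<Longrightarrow> cinner x y = 0"
  using sum_V by (simp add: orthogonal_direct_sum_def)

lemma H_span: "H = cvec.span (\<Union>k. V k)"
  using sum_V by (simp add: orthogonal_direct_sum_def)

lemma V_subset: "V k \<subseteq> H"
  unfolding H_span by (auto intro: cvec.span_base)

lemma action_closed: "x \<in> H \<Longrightarrow> \<pi> A x \<in> H"
  and action_add: "x \<in> H \<Longrightarrow> y \<in> H \<Longrightarrow> \<pi> A (x + y) = \<pi> A x + \<pi> A y"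
  and action_scale: "x \<in> H \<Longrightarrow> \<pi> A (c *\<^sub>C x) = c *\<^sub>C \<pi> A x"
  using action by (simp_all add: witt_action_def operator_on_def)

lemma action_zero: "\<pi> A 0 = 0"
  using action_scale[of 0 A 0] subspace_H by (simp add: cvec.subspace_0)

lemma pi_add: "x \<in> H \<Longrightarrow> \<pi> (A + B) x = \<pi> A x + \<pi> B x"
  and pi_scale: "x \<in> H \<Longrightarrow> \<pi> (witt_scale c A) x = c *\<^sub>C \<pi> A x"
  using projective by (simp_all add: projective_rep_def)

lemma bracket_commutator:
  assumes "witt_even A \<or> witt_odd A" and "witt_even B \<or> witt_odd B"
    and "\<not> (witt_odd A \<and> witt_odd B)"
  shows "\<exists>c. \<forall>x\<in>H. \<pi> A (\<pi> B x) - \<pi> B (\<pi> A x) - \<pi> (witt_bracket A B) x = c *\<^sub>C x"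
proof -
  have "\<exists>c. \<forall>x\<in>H. (if witt_odd A \<and> witt_odd B
      then \<pi> A (\<pi> B x) + \<pi> B (\<pi> A x)
      else \<pi> A (\<pi> B x) - \<pi> B (\<pi> A x)) - \<pi> (witt_bracket A B) x = c *\<^sub>C x"
    using projective assms(1,2) unfolding projective_rep_def by blast
  then show ?thesis by (simp only: assms(3) if_False)
qed

text \<open>The graded bracket as an exchange rule, with \<open>s = -1\<close> for two odd elements
  and \<open>s = 1\<close> otherwise. The values of \<open>s\<close> and \<open>c\<close> stay
  existential because the rule only serves to show membership in a span.\<close>

lemma bracket_scalar:
  assumes "witt_even A \<or> witt_odd A" and "witt_even B \<or> witt_odd B"
  shows "\<exists>s c. \<forall>x\<in>H. \<pi> A (\<pi> B x) = s *\<^sub>C \<pi> B (\<pi> A x) + \<pi> (witt_bracket A B) x + c *\<^sub>C x"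
proof (cases "witt_odd A \<and> witt_odd B")
  case True
  have "\<exists>c. \<forall>x\<in>H. (if witt_odd A \<and> witt_odd B
      then \<pi> A (\<pi> B x) + \<pi> B (\<pi> A x)
      else \<pi> A (\<pi> B x) - \<pi> B (\<pi> A x)) - \<pi> (witt_bracket A B) x = c *\<^sub>C x"
    using projective assms unfolding projective_rep_def by blast
  then obtain c where c: "\<And>x. x \<in> H \<Longrightarrow>
      \<pi> A (\<pi> B x) + \<pi> B (\<pi> A x) - \<pi> (witt_bracket A B) x = c *\<^sub>C x"
    unfolding if_P[OF True] by blast
  have "\<pi> A (\<pi> B x) = (- 1) *\<^sub>C \<pi> B (\<pi> A x) + \<pi> (witt_bracket A B) x + c *\<^sub>C x"
    if "x \<in> H" for x
    using c[OF that, symmetric] by (simp add: cvec.scale_minus_left scaleC_one)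
  then show ?thesis by blast
next
  case False
  obtain c where c: "\<And>x. x \<in> H \<Longrightarrow>
      \<pi> A (\<pi> B x) - \<pi> B (\<pi> A x) - \<pi> (witt_bracket A B) x = c *\<^sub>C x"
    using bracket_commutator[OF assms False] by blast
  have "\<pi> A (\<pi> B x) = 1 *\<^sub>C \<pi> B (\<pi> A x) + \<pi> (witt_bracket A B) x + c *\<^sub>C x"
    if "x \<in> H" for x
    using c[OF that, symmetric] by (simp add: scaleC_one)
  then show ?thesis by blast
qed

lemma action_span_invariant:
  assumes S: "S \<subseteq> H" "\<And>x. x \<in> S \<Longrightarrow> \<pi> A x \<in> cvec.span S" and x: "x \<in> cvec.span S"
  shows "\<pi> A x \<in> cvec.span S"
proof -
  let ?T = "{x \<in> H. \<pi> A x \<in> cvec.span S}"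
  have "cvec.subspace ?T"
    using subspace_H
    by (auto simp: cvec.subspace_def action_zero action_add action_scale cvec.span_zero
        cvec.span_add cvec.span_scale)
  then have "cvec.span S \<subseteq> ?T" using S by (intro cvec.span_minimal) auto
  then show ?thesis using x by blast
qed

text \<open>By linearity of \<open>\<pi>\<close> in its first argument: every \<open>A\<close>
  arises from 0 by adding multiples of generators one at a time.\<close>

lemma action_from_gens:
  assumes N: "cvec.subspace N" and x: "x \<in> H" and gens: "\<And>g. \<pi> (gen g) x \<in> N"
  shows "\<pi> A x \<in> N"
proof (induction A rule: update_induct)
  case const
  have "\<pi> 0 x + \<pi> 0 x = \<pi> 0 x" using pi_add[OF x, of 0 0] by simp
  then show ?case using N by (simp add: cvec.subspace_0)
next
  case (update f a b)
  \<comment> \<open>The key \<open>a\<close> is new, so setting its value is the same as adding a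
    multiple of \<open>gen a\<close>.\<close>
  have "Poly_Mapping.update a b f = f + Poly_Mapping.single a b"
    using update(1)
    by (intro poly_mapping_eqI)
      (auto simp: lookup_update lookup_add lookup_single when_def in_keys_iff)
  also have "Poly_Mapping.single a b = witt_scale b (gen a)"
    by (simp add: gen_def witt_scale_single)
  finally have "\<pi> (Poly_Mapping.update a b f) x = \<pi> f x + b *\<^sub>C \<pi> (gen a) x"
    using x by (simp add: pi_add pi_scale)
  then show ?case
    using update.IH gens N by (simp add: cvec.subspace_add cvec.subspace_scale)
qed

section \<open>Energy components and the degree of the generators\<close>

lemma homogeneous_components:
  assumes "x \<in> H"
  shows "\<exists>F f. finite F \<and> (\<forall>k. f k \<in> V k) \<and> x = sum f F"
proof -
  have "x \<in> cvec.span (\<Union>k. V k)" using assms H_span by simp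
  \<comment> \<open>The clause that \<open>f\<close> vanishes off \<open>F\<close> makes the
    induction work: the index set can then grow without changing the sum.\<close>
  then have "\<exists>F f. finite F \<and> (\<forall>k. f k \<in> V k) \<and> (\<forall>k. k \<notin> F \<longrightarrow> f k = 0) \<and> x = sum f F"
  proof (induction rule: cvec.span_induct_alt)
    case base
    show ?case
      using cvec.subspace_0[OF subspace_V] by (intro exI[of _ "{}"] exI[of _ "\<lambda>_. 0"]) simp
  next
    case (step c x y)
    then obtain i F f where i: "x \<in> V i" and F: "finite F" "\<And>k. f k \<in> V k"
      "\<And>k. k \<notin> F \<Longrightarrow> f k = 0" "y = sum f F"
      by blast
    define f' where "f' k = (if k = i then c *\<^sub>C x else 0) + f k" for k
    have "f' k \<in> V k" for k
      unfolding f'_def using i F(2)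
      by (auto intro: cvec.subspace_add cvec.subspace_scale subspace_V)
    moreover have "f' k = 0" if "k \<notin> insert i F" for k
      using that F(3) by (simp add: f'_def)
    moreover have "sum f (insert i F) = sum f F"
      using F(1,3) by (intro sum.mono_neutral_right) auto
    then have "c *\<^sub>C x + y = sum f' (insert i F)"
      unfolding f'_def sum.distrib using F(1,4) by simp
    ultimately show ?case
      using F(1) by (intro exI[of _ "insert i F"] exI[of _ f']) simp
  qed
  then show ?thesis by blast
qed

text \<open>Subtracting \<open>a/2\<close> from \<open>D\<close> kills the component with index
  \<open>a\<close> and multiplies every other one by a nonzero number. The result is a shorter sum
  that still lies in \<open>K\<close>, so induction on the number of components applies.\<close>

lemma components_in_invariant_subspace:
  assumes K: "cvec.subspace K" "K \<subseteq> H" "\<And>x. x \<in> K \<Longrightarrow> D x \<in> K"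
    and "finite F" and "\<And>k. f k \<in> V k" and "sum f F \<in> K" and "k \<in> F"
  shows "f k \<in> K"
  using assms(4-)
proof (induction F arbitrary: f k rule: finite_induct)
  case empty
  then show ?case by simp
next
  case (insert a F)
  define x where "x = sum f (insert a F)"
  define f' where "f' j = (of_nat j / 2 - of_nat a / 2 :: complex) *\<^sub>C f j" for j
  have sum_D: "D (sum f F') = (\<Sum>j\<in>F'. (of_nat j / 2) *\<^sub>C f j)" if "finite F'" for F'
    using that
  proof (induction F' rule: finite_induct)
    case empty
    have "D (0 *\<^sub>C 0) = 0 *\<^sub>C D 0"
      using D_operator subspace_H unfolding operator_on_def by (blast intro: cvec.subspace_0)
    then show ?case by simp
  next
    case (insert j F')
    have "f j \<in> H" "sum f F' \<in> H"
      using insert.prems V_subset \<open>\<And>k. f k \<in> V k\<close>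
      by (auto intro!: cvec.subspace_sum[OF subspace_H])
    then show ?case
      using insert D_operator D_V \<open>\<And>k. f k \<in> V k\<close> by (simp add: operator_on_def)
  qed
  have "x \<in> K" using insert.prems by (simp add: x_def)
  then have "D x - (of_nat a / 2) *\<^sub>C x \<in> K"
    using K by (intro cvec.subspace_diff cvec.subspace_scale) auto
  also have "D x - (of_nat a / 2) *\<^sub>C x = sum f' (insert a F)"
    unfolding x_def f'_def using insert.hyps(1)
    by (subst sum_D) (auto simp: cvec.scale_sum_right sum_subtractf cvec.scale_left_diff_distrib)
  also have "\<dots> = sum f' F" using insert.hyps by (simp add: f'_def)
  finally have "sum f' F \<in> K" .
  moreover have "f' j \<in> V j" for j
    unfolding f'_def using insert.prems by (blast intro: cvec.subspace_scale subspace_V)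
  ultimately have f'K: "f' j \<in> K" if "j \<in> F" for j
    using insert.IH that by blast
  have fK: "f j \<in> K" if "j \<in> F" for j
  proof -
    have "j \<noteq> a" using that insert.hyps by blast
    \<comment> \<open>Different indices have different eigenvalues, so the factor can be divided
      out.\<close>
    then have "f j = (1 / (of_nat j / 2 - of_nat a / 2)) *\<^sub>C f' j"
      by (simp add: f'_def scaleC_scaleC scaleC_one)
    then show ?thesis using f'K[OF that] K(1) by (metis cvec.subspace_scale)
  qed
  have "f a = x - sum f F" using insert.hyps by (simp add: x_def)
  also have "\<dots> \<in> K"
    using \<open>x \<in> K\<close> fK K(1) by (intro cvec.subspace_diff cvec.subspace_sum)
  finally show ?case using fK insert.prems by auto
qed

text \<open>The eigenspace of \<open>D\<close> for \<open>c\<close> is \<open>D\<close>-invariant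
  and so contains the components of \<open>y\<close>. A nonzero component with index
  \<open>k\<close> forces \<open>c = k/2\<close>, which leaves room for only one such
  \<open>k\<close>.\<close>

lemma eigenvector_zero_or_in_V:
  assumes "y \<in> H" and "D y = c *\<^sub>C y"
  shows "y = 0 \<or> (\<exists>k. c = of_nat k / 2 \<and> y \<in> V k)"
proof (cases "y = 0")
  case False
  define K where "K = {x \<in> H. D x = c *\<^sub>C x}"
  obtain F f where F: "finite F" "\<And>k. f k \<in> V k" "y = sum f F"
    using homogeneous_components[OF assms(1)] by blast
  have D0: "D 0 = 0"
    using D_operator cvec.subspace_0[OF subspace_H] unfolding operator_on_def
    by (metis cvec.scale_zero_left)
  have K: "cvec.subspace K"
    using D_operator subspace_H D0
    by (auto simp: K_def cvec.subspace_def operator_on_def scaleC_add_right scaleC_scaleC mult.commute)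
  have KD: "D x \<in> K" if "x \<in> K" for x
    using that K cvec.subspace_scale[OF K that, of c] by (simp add: K_def)
  have "f k \<in> K" if "k \<in> F" for k
    using components_in_invariant_subspace[OF K _ KD F(1,2) _ that] F(3) assms
    by (auto simp: K_def)
  then have zero: "f k = 0" if "k \<in> F" "c \<noteq> of_nat k / 2" for k
    using that D_V[OF F(2), of k] by (auto simp: K_def)
  obtain i where i: "i \<in> F" "f i \<noteq> 0" using False F(3) by (metis sum.neutral)
  then have ci: "c = of_nat i / 2" using zero by blast
  have "f k = 0" if "k \<in> F - {i}" for k using zero[of k] that ci by auto
  then have "y = f i" using F(1,3) i(1) by (simp add: sum.remove)
  then show ?thesis using ci F(2) by blast
qed simp

text \<open>A projective representation may add a scalar to each generator (as happens on sums of
  one-dimensional modules), so generators are homogeneous only up to a shift.\<close>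

lemma homogeneous_shift:
  "\<exists>a. \<forall>k. \<forall>x\<in>V k. \<pi> (gen g) x - a *\<^sub>C x = 0 \<or>
      (\<exists>j. int j = int k - gen_deg g \<and> \<pi> (gen g) x - a *\<^sub>C x \<in> V j)"
proof -
  let ?l = "of_int (gen_deg g) / 2 :: complex"
  obtain a where a: "\<And>x k. x \<in> V k \<Longrightarrow>
      D (\<pi> (gen g) x - a *\<^sub>C x) = (of_nat k / 2 - ?l) *\<^sub>C (\<pi> (gen g) x - a *\<^sub>C x)"
  proof (cases "gen_deg g = 0")
    case True
    \<comment> \<open>Odd generators have odd \<open>gen_deg\<close>, so only \<open>d_0\<close> has
      degree zero. There \<open>a = h\<close> works, since \<open>D\<close> is the action of
      \<open>d_0\<close> minus \<open>h\<close>.\<close>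
    then have g: "g = Dgen 0" by (cases g) (auto, presburger)
    have "D (\<pi> (gen g) x - h *\<^sub>C x) = (of_nat k / 2 - ?l) *\<^sub>C (\<pi> (gen g) x - h *\<^sub>C x)"
      if x: "x \<in> V k" for x k
    proof -
      have "\<pi> (gen g) x - h *\<^sub>C x = (of_nat k / 2) *\<^sub>C x"
        using D_eq[OF subsetD[OF V_subset x]] D_V[OF x] g by simp
      moreover have "(of_nat k / 2) *\<^sub>C x \<in> V k"
        by (rule cvec.subspace_scale[OF subspace_V x])
      ultimately show ?thesis using D_V True by simp
    qed
    then show thesis by (rule that)
  next
    case False
    obtain c where c: "\<And>x. x \<in> H \<Longrightarrow> \<pi> (gen (Dgen 0)) (\<pi> (gen g) x)
        - \<pi> (gen g) (\<pi> (gen (Dgen 0)) x) - \<pi> (witt_bracket (gen (Dgen 0)) (gen g)) x = c *\<^sub>C x"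
      using bracket_commutator[OF gen_homogeneous gen_homogeneous] gen_Dgen_not_odd by blast
    \<comment> \<open>The commutator of \<open>d_0\<close> with the generator produces the scalar
      \<open>c\<close>. The condition that the shifted vector is an eigenvector of \<open>D\<close>
      reads \<open>c = a * ?l\<close>, and its solution does not depend on \<open>k\<close>.\<close>
    define a where "a = c / ?l"
    have "D (\<pi> (gen g) x - a *\<^sub>C x) = (of_nat k / 2 - ?l) *\<^sub>C (\<pi> (gen g) x - a *\<^sub>C x)"
      if x: "x \<in> V k" for x k
    proof -
      define y where "y = \<pi> (gen g) x"
      have xH: "x \<in> H" using x V_subset by blast
      have yH: "y \<in> H" using xH by (simp add: y_def action_closed)
      have d0x: "\<pi> (gen (Dgen 0)) x = (of_nat k / 2 + h) *\<^sub>C x"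
        using D_eq[OF xH] D_V[OF x] by (simp add: cvec.scale_left_distrib algebra_simps)
      have "\<pi> (gen (Dgen 0)) y - (of_nat k / 2 + h) *\<^sub>C y - (- ?l) *\<^sub>C y = c *\<^sub>C x"
        using c[OF xH] by (simp add: d0x bracket_d0_gen pi_scale action_scale xH y_def)
      then have "\<pi> (gen (Dgen 0)) y = (of_nat k / 2 + h) *\<^sub>C y - ?l *\<^sub>C y + c *\<^sub>C x"
        by (simp add: cvec.scale_minus_left algebra_simps)
      then have Dy: "D y = (of_nat k / 2 - ?l) *\<^sub>C y + c *\<^sub>C x"
        unfolding D_eq[OF yH]
        by (simp add: cvec.scale_left_distrib cvec.scale_left_diff_distrib)
      have "D (y - a *\<^sub>C x) = D (y + (- a) *\<^sub>C x)" by (simp add: cvec.scale_minus_left)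
      also have "\<dots> = D y + D ((- a) *\<^sub>C x)"
        using D_operator yH cvec.subspace_scale[OF subspace_H xH] by (simp only: operator_on_def)
      also have "\<dots> = D y + (- a) *\<^sub>C D x"
        using D_operator xH by (simp only: operator_on_def)
      also have "\<dots> = (of_nat k / 2 - ?l) *\<^sub>C y + (c - a * (of_nat k / 2)) *\<^sub>C x"
        by (simp add: Dy D_V[OF x] scaleC_scaleC cvec.scale_left_diff_distrib
            cvec.scale_minus_left algebra_simps)
      also have "c - a * (of_nat k / 2) = - ((of_nat k / 2 - ?l) * a)"
        using False by (simp add: a_def field_simps)
      also have "(of_nat k / 2 - ?l) *\<^sub>C y + (- ((of_nat k / 2 - ?l) * a)) *\<^sub>C x
          = (of_nat k / 2 - ?l) *\<^sub>C (y - a *\<^sub>C x)"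
        by (simp add: cvec.scale_right_diff_distrib scaleC_scaleC cvec.scale_minus_left)
      finally show ?thesis by (simp add: y_def)
    qed
    then show thesis by (rule that)
  qed
  have "\<pi> (gen g) x - a *\<^sub>C x = 0 \<or>
      (\<exists>j. int j = int k - gen_deg g \<and> \<pi> (gen g) x - a *\<^sub>C x \<in> V j)" if x: "x \<in> V k" for k x
  proof -
    have "\<pi> (gen g) x - a *\<^sub>C x \<in> H"
      using x V_subset action_closed
      by (blast intro: cvec.subspace_diff cvec.subspace_scale subspace_H)
    \<comment> \<open>The shifted vector has eigenvalue \<open>k/2 - ?l\<close>, so either it
      vanishes or this number is half of a natural number \<open>j\<close>.\<close>
    from eigenvector_zero_or_in_V[OF this a[OF x]]
    consider "\<pi> (gen g) x - a *\<^sub>C x = 0"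
      | j where "of_nat k / 2 - ?l = of_nat j / 2" "\<pi> (gen g) x - a *\<^sub>C x \<in> V j"
      by blast
    then show ?thesis
    proof cases
      case 2
      then have "(of_nat k - of_int (gen_deg g) :: complex) = of_nat j"
        by (simp only: diff_divide_distrib[symmetric] divide_cancel_right) simp
      then have "(of_int (int k - gen_deg g) :: complex) = of_int (int j)" by simp
      then have "int j = int k - gen_deg g" by (simp only: of_int_eq_iff)
      with 2 show ?thesis by blast
    qed simp
  qed
  then show ?thesis by blast
qed

section \<open>Words of raising generators applied to a lowest vector\<close>

definition shift :: "witt_gen \<Rightarrow> complex" where
  "shift g = (SOME a. \<forall>k. \<forall>x\<in>V k. \<pi> (gen g) x - a *\<^sub>C x = 0 \<or>
      (\<exists>j. int j = int k - gen_deg g \<and> \<pi> (gen g) x - a *\<^sub>C x \<in> V j))"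

definition hom_op :: "witt_gen \<Rightarrow> 'h \<Rightarrow> 'h" where
  "hom_op g x = \<pi> (gen g) x - shift g *\<^sub>C x"

text \<open>As \<open>j\<close> is a natural number, the first alternative must hold whenever the
  energy would become negative; this is how lowering operators annihilate a lowest vector.\<close>

lemma hom_op_degree:
  assumes "x \<in> V k"
  shows "hom_op g x = 0 \<or> (\<exists>j. int j = int k - gen_deg g \<and> hom_op g x \<in> V j)"
  unfolding hom_op_def shift_def using someI_ex[OF homogeneous_shift[of g]] assms by blast

text \<open>Negative \<open>gen_deg\<close> means raising the energy. Using \<open>hom_op\<close>
  instead of the bare action keeps every word homogeneous. The words are not put in any normal
  order, since only their span matters.\<close>

inductive_set raised :: "'h \<Rightarrow> 'h set" for v where
  base: "v \<in> raised v"
| raise: "u \<in> raised v \<Longrightarrow> gen_deg g < 0 \<Longrightarrow> hom_op g u \<in> raised v"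

text \<open>Each letter strictly increases the energy, so a nonzero word other than \<open>v\<close>
  itself has positive energy.\<close>

lemma raised_subset:
  assumes "v \<in> V 0" and "u \<in> raised v"
  shows "u = v \<or> u = 0 \<or> (\<exists>k>0. u \<in> V k)"
  using assms(2)
proof induction
  case (raise u g)
  have "\<exists>k. u \<in> V k" using raise.IH assms(1) cvec.subspace_0[OF subspace_V, of 0] by auto
  then obtain k where u: "u \<in> V k" ..
  from hom_op_degree[OF u, of g] show ?case
  proof (elim disjE exE conjE)
    fix j assume "int j = int k - gen_deg g" and "hom_op g u \<in> V j"
    moreover from this have "j > 0" using raise.hyps(2) by linarith
    ultimately show ?thesis by blast
  qed simp
qed simp

lemma span_raised_subset:
  assumes "v \<in> V 0"
  shows "cvec.span (raised v) \<subseteq> H"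
proof (rule cvec.span_minimal[OF _ subspace_H])
  show "raised v \<subseteq> H"
    using raised_subset[OF assms] subsetD[OF V_subset] assms cvec.subspace_0[OF subspace_H] by auto
qed

lemma raising_span_raised:
  assumes v: "v \<in> V 0" and g: "gen_deg g < 0" and x: "x \<in> cvec.span (raised v)"
  shows "\<pi> (gen g) x \<in> cvec.span (raised v)"
proof (rule action_span_invariant[OF _ _ x])
  show "raised v \<subseteq> H"
    using span_raised_subset[OF v] cvec.span_superset by blast
  show "\<pi> (gen g) u \<in> cvec.span (raised v)" if u: "u \<in> raised v" for u
  proof -
    have "\<pi> (gen g) u = hom_op g u + shift g *\<^sub>C u" by (simp add: hom_op_def)
    then show ?thesis
      using raised.raise[OF u g] u by (simp add: cvec.span_add cvec.span_scale cvec.span_base)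
  qed
qed

text \<open>Moving a generator to the right through a raising word costs a bracket, which is again a
  linear combination of generators and scalars acting on a shorter word.\<close>

lemma span_raised_gen_invariant:
  assumes v: "v \<in> V 0" and u: "u \<in> raised v"
  shows "\<pi> (gen g) u \<in> cvec.span (raised v)"
  using u
proof (induction arbitrary: g)
  let ?N = "cvec.span (raised v)"
  note H = subsetD[OF span_raised_subset[OF v]]
  {
    case base
    \<comment> \<open>Three cases by the sign of the degree: a raising generator yields a word,
      \<open>d_0\<close> acts on \<open>v\<close> by the scalar \<open>h\<close>, and a lowering
      generator kills \<open>v\<close>.\<close>
    have "hom_op g v \<in> ?N"
    proof (cases "gen_deg g < 0")
      case True
      then show ?thesis by (blast intro: cvec.span_base raised.intros)
    next
      case False
      show ?thesis
      proof (cases "gen_deg g = 0")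
        case True
        then have g: "g = Dgen 0" by (cases g) (auto, presburger)
        have "\<pi> (gen g) v = h *\<^sub>C v" using D_eq[OF subsetD[OF V_subset v]] D_V[OF v] g by simp
        then show ?thesis
          unfolding hom_op_def
          by (simp add: cvec.span_diff cvec.span_scale cvec.span_base raised.base)
      next
        case nz: False
        then have "hom_op g v = 0" using hom_op_degree[OF v, of g] False by auto
        then show ?thesis by (simp add: cvec.span_zero)
      qed
    qed
    moreover have "\<pi> (gen g) v = hom_op g v + shift g *\<^sub>C v" by (simp add: hom_op_def)
    ultimately show ?case
      by (auto intro: cvec.span_add cvec.span_scale cvec.span_base raised.base)
  next
    case (raise u f)
    have uN: "u \<in> ?N" using raise.hyps by (simp add: cvec.span_base)
    then have uH: "u \<in> H" by (rule H)
    \<comment> \<open>Once \<open>g\<close> has passed \<open>f\<close>, it acts on the shorter word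
      \<open>u\<close>, where the induction hypothesis is available for all generators;
      \<open>f\<close> then preserves the span because it raises.\<close>
    obtain s c where sc: "\<pi> (gen g) (\<pi> (gen f) u)
        = s *\<^sub>C \<pi> (gen f) (\<pi> (gen g) u) + \<pi> (witt_bracket (gen g) (gen f)) u + c *\<^sub>C u"
      using bracket_scalar[OF gen_homogeneous gen_homogeneous] uH by blast
    note f = raising_span_raised[OF v raise.hyps(2)]
    have br: "\<pi> (witt_bracket (gen g) (gen f)) u \<in> ?N"
      by (rule action_from_gens[OF cvec.subspace_span uH raise.IH])
    have gf: "\<pi> (gen g) (\<pi> (gen f) u) \<in> ?N"
      unfolding sc using br uN by (intro cvec.span_add cvec.span_scale f raise.IH)
    have "hom_op f u = \<pi> (gen f) u + (- shift f) *\<^sub>C u"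
      by (simp add: hom_op_def cvec.scale_minus_left)
    moreover have "(- shift f) *\<^sub>C u \<in> H" using uH subspace_H by (blast intro: cvec.subspace_scale)
    ultimately have "\<pi> (gen g) (hom_op f u)
        = \<pi> (gen g) (\<pi> (gen f) u) + (- shift f) *\<^sub>C \<pi> (gen g) u"
      using uH by (simp only: action_add action_scale action_closed)
    also have "\<dots> \<in> ?N" using gf raise.IH by (blast intro: cvec.span_add cvec.span_scale)
    finally show ?case .
  }
qed

lemma span_raised_submodule:
  assumes v: "v \<in> V 0"
  shows "submodule H \<pi> (cvec.span (raised v))"
proof -
  let ?N = "cvec.span (raised v)"
  note H = subsetD[OF span_raised_subset[OF v]]
  have "\<pi> A x \<in> ?N" if "x \<in> ?N" for A x
  proof (rule action_span_invariant[OF _ _ that])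
    show "raised v \<subseteq> H" using span_raised_subset[OF v] cvec.span_superset by blast
    show "\<pi> A u \<in> ?N" if u: "u \<in> raised v" for u
      by (rule action_from_gens[OF cvec.subspace_span H[OF cvec.span_base[OF u]]
            span_raised_gen_invariant[OF v u]])
  qed
  then show ?thesis
    unfolding submodule_def using span_raised_subset[OF v] by (simp add: cvec.subspace_span)
qed

text \<open>Removing from \<open>x\<close> its projection onto \<open>v\<close> leaves a vector
  \<open>y\<close> of energy 0 orthogonal to \<open>v\<close>, hence to all words, the others having
  positive energy or being zero. But \<open>y\<close> lies in the span of the words, so it is
  orthogonal to itself.\<close>

lemma span_raised_lowest:
  assumes v: "v \<in> V 0" "v \<noteq> 0" and x: "x \<in> cvec.span (raised v)" "x \<in> V 0"
  shows "\<exists>c. x = c *\<^sub>C v"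
proof -
  define c where "c = cinner x v / cinner v v"
  define y where "y = x - c *\<^sub>C v"
  have yv: "cinner y v = 0"
    using v(2) by (simp add: y_def c_def cinner_diff_left cinner_scaleC_left cinner_eq_zero_iff)
  have yN: "y \<in> cvec.span (raised v)"
    unfolding y_def using x(1) by (simp add: cvec.span_diff cvec.span_scale cvec.span_base raised.base)
  have y0: "y \<in> V 0"
    unfolding y_def using x(2) v(1) by (blast intro: cvec.subspace_diff cvec.subspace_scale subspace_V)
  have "cinner y u = 0" if "u \<in> raised v" for u
    using raised_subset[OF v(1) that] yv V_orthogonal[OF y0] by fastforce
  then have "cinner y y = 0" using yN by (rule orthogonal_span_right)
  then have "x = c *\<^sub>C v" by (simp add: cinner_eq_zero_iff y_def)
  then show ?thesis ..
qed

section \<open>Submodules, orthogonal complements and irreducibility\<close>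

lemma submodule_D: "submodule H \<pi> K \<Longrightarrow> x \<in> K \<Longrightarrow> D x \<in> K"
  using D_eq unfolding submodule_def
  by (metis (no_types, lifting) cvec.subspace_diff cvec.subspace_scale subsetD)

text \<open>Submodules are graded: they are invariant under \<open>D\<close>, because
  \<open>D\<close> differs from the action of \<open>d_0\<close> by a scalar.\<close>

lemma submodule_components:
  assumes "submodule H \<pi> K" and "x \<in> K"
  shows "\<exists>F f. finite F \<and> (\<forall>k. f k \<in> V k) \<and> (\<forall>k\<in>F. f k \<in> K) \<and> x = sum f F"
proof -
  have K: "cvec.subspace K" "K \<subseteq> H" using assms(1) by (simp_all add: submodule_def)
  obtain F f where F: "finite F" "\<And>k. f k \<in> V k" "x = sum f F"
    using homogeneous_components assms(2) K(2) by blast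
  have "f k \<in> K" if "k \<in> F" for k
    using components_in_invariant_subspace[OF K submodule_D[OF assms(1)] F(1,2) _ that] F(3) assms(2)
    by simp
  then show ?thesis using F by blast
qed

text \<open>By unitarity the action moves to the other argument as that of
  \<open>witt_star A\<close>, which preserves \<open>S\<close>.\<close>

lemma orthogonal_complement_submodule:
  assumes S: "S \<subseteq> H" "\<And>A x. x \<in> S \<Longrightarrow> \<pi> A x \<in> S"
  shows "submodule H \<pi> {x \<in> H. \<forall>s\<in>S. cinner x s = 0}"
proof -
  have "cinner (\<pi> A x) s = 0" if "x \<in> H" "\<forall>s\<in>S. cinner x s = 0" "s \<in> S" for A x s
    using unitary that S unfolding unitary_rep_def by (metis subsetD)
  then show ?thesis
    using subspace_H
    by (auto simp: submodule_def cvec.subspace_def cinner_add_left cinner_scaleC_left action_closed)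
qed

lemma generated_irreducible:
  assumes v: "v \<in> V 0" "v \<noteq> 0"
  shows "irreducible_rep (generated_submodule H \<pi> v) \<pi>"
proof -
  let ?M = "generated_submodule H \<pi> v"
  have vH: "v \<in> H" using v V_subset by blast
  have M: "submodule H \<pi> ?M" by (rule submodule_generated[OF action vH])
  have "K = {0} \<or> K = ?M" if K: "submodule ?M \<pi> K" for K
  proof -
    have KH: "submodule H \<pi> K" using M K by (rule submodule_trans)
    then have subK: "cvec.subspace K" by (simp add: submodule_def)
    have KM: "K \<subseteq> ?M" using K by (simp add: submodule_def)
    show ?thesis
    proof (cases "\<exists>w\<in>K. cinner w v \<noteq> 0")
      case True
      then obtain w where w: "w \<in> K" "cinner w v \<noteq> 0" by blast
      obtain F f where F: "finite F" "\<And>k. f k \<in> V k" "\<And>k. k \<in> F \<Longrightarrow> f k \<in> K" "w = sum f F"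
        using submodule_components[OF KH w(1)] by blast
      have "\<exists>k\<in>F. cinner (f k) v \<noteq> 0"
      proof (rule ccontr)
        assume "\<not> ?thesis"
        then have "w \<in> {x. cinner x v = 0}"
          unfolding F(4) by (intro cvec.subspace_sum subspace_orthogonal_left) auto
        with w(2) show False by simp
      qed
      then obtain k where k: "k \<in> F" "cinner (f k) v \<noteq> 0" by blast
      \<comment> \<open>Only a component of energy 0 can fail to be orthogonal to \<open>v\<close>.
        It lies in \<open>K\<close>, and it is a multiple of \<open>v\<close> because the generated
        module has only the line through \<open>v\<close> at energy 0.\<close>
      then have "k = 0" using V_orthogonal F(2) v(1) by blast
      then have f0: "f 0 \<in> K" "f 0 \<in> V 0" "cinner (f 0) v \<noteq> 0" using k F by auto
      have "?M \<subseteq> cvec.span (raised v)"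
        using span_raised_submodule[OF v(1)]
        by (intro generated_submodule_minimal) (auto intro: cvec.span_base raised.base)
      then have "f 0 \<in> cvec.span (raised v)" using f0(1) KM by blast
      then obtain c where c: "f 0 = c *\<^sub>C v" using span_raised_lowest[OF v _ f0(2)] by blast
      with f0(3) have "c \<noteq> 0" by auto
      then have "v = (1 / c) *\<^sub>C f 0" by (simp add: c scaleC_scaleC scaleC_one)
      then have "v \<in> K" using f0(1) subK by (metis cvec.subspace_scale)
      then have "?M \<subseteq> K" by (rule generated_submodule_minimal[OF KH])
      with KM show ?thesis by blast
    next
      case False
      \<comment> \<open>The complement of \<open>K\<close> is a submodule containing
        \<open>v\<close>, so it contains all of \<open>?M\<close> and in particular
        \<open>K\<close>; thus \<open>K\<close> is orthogonal to itself.\<close>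
      have "submodule H \<pi> {x \<in> H. \<forall>s\<in>K. cinner x s = 0}"
        using KH by (intro orthogonal_complement_submodule) (auto simp: submodule_def)
      moreover have "v \<in> {x \<in> H. \<forall>s\<in>K. cinner x s = 0}"
        using False vH cinner_eq_0_sym by blast
      ultimately have "?M \<subseteq> {x \<in> H. \<forall>s\<in>K. cinner x s = 0}" by (rule generated_submodule_minimal)
      then have "K \<subseteq> {0}" using KM cinner_eq_zero_iff by blast
      then show ?thesis using subK cvec.subspace_0 by blast
    qed
  qed
  moreover have "?M \<noteq> {0}" using generated_submodule_base[of v H \<pi>] v(2) by blast
  ultimately show ?thesis
    using submodule_witt_action[OF action M] by (simp add: irreducible_rep_def)
qed

text \<open>A submodule inherits the energy spaces, but its lowest energy may be higher. The
  summands are renumbered from the least energy that occurs, and the constant \<open>h\<close>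
  absorbs the difference.\<close>

lemma submodule_graded:
  assumes K: "submodule H \<pi> K" and nz: "K \<noteq> {0}"
  shows "\<exists>V' D' h'. graded_witt_rep K \<pi> V' D' h' \<and> V' 0 \<noteq> {0}"
proof -
  have sK: "cvec.subspace K" and KH: "K \<subseteq> H" using K by (simp_all add: submodule_def)
  define k0 where "k0 = (LEAST k. K \<inter> V k \<noteq> {0})"
  define V' where "V' k = K \<inter> V (k0 + k)" for k
  define D' where "D' x = D x - (of_nat k0 / 2) *\<^sub>C x" for x
  have "\<exists>k. K \<inter> V k \<noteq> {0}"
  proof (rule ccontr)
    assume "\<not> ?thesis"
    then have none: "K \<inter> V k = {0}" for k by blast
    have "x = 0" if x: "x \<in> K" for x
    proof -
      obtain F f where F: "finite F" "\<And>k. f k \<in> V k" "\<And>k. k \<in> F \<Longrightarrow> f k \<in> K" "x = sum f F"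
        using submodule_components[OF K x] by blast
      have "f k = 0" if "k \<in> F" for k using none[of k] F(2)[of k] F(3)[OF that] by auto
      then show ?thesis using F(4) by simp
    qed
    then show False using nz sK cvec.subspace_0 by blast
  qed
  then have k0: "K \<inter> V k0 \<noteq> {0}" unfolding k0_def by (rule LeastI_ex)
  have below: "K \<inter> V k = {0}" if "k < k0" for k
    using not_less_Least[of k "\<lambda>k. K \<inter> V k \<noteq> {0}"] that unfolding k0_def by blast
  have "K \<subseteq> cvec.span (\<Union>k. V' k)"
  proof
    fix x assume "x \<in> K"
    then obtain F f where F: "finite F" "\<And>k. f k \<in> V k" "\<And>k. k \<in> F \<Longrightarrow> f k \<in> K" "x = sum f F"
      using submodule_components[OF K] by blast
    have "f k \<in> cvec.span (\<Union>k. V' k)" if "k \<in> F" for k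
    proof (cases "k < k0")
      case True
      then have "f k = 0" using below[of k] F(2)[of k] F(3)[OF that] by auto
      then show ?thesis by (simp add: cvec.span_zero)
    next
      case False
      then have "f k \<in> V' (k - k0)" using F(2,3) that by (simp add: V'_def)
      then show ?thesis by (blast intro: cvec.span_base)
    qed
    then show "x \<in> cvec.span (\<Union>k. V' k)" unfolding F(4) by (rule cvec.span_sum)
  qed
  moreover have "cvec.span (\<Union>k. V' k) \<subseteq> K"
    using sK by (intro cvec.span_minimal) (auto simp: V'_def)
  ultimately have span: "K = cvec.span (\<Union>k. V' k)" by (rule equalityI)
  have sV': "cvec.subspace (V' k)" for k
    unfolding V'_def by (intro cvec.subspace_inter sK subspace_V)
  have "graded_witt_rep K \<pi> V' D' (h + of_nat k0 / 2)"
  proof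
    show "witt_action K \<pi>" "unitary_rep K \<pi>" "projective_rep K \<pi>"
      by (rule submodule_witt_action[OF action K] submodule_unitary_rep[OF unitary K]
          submodule_projective_rep[OF projective K])+
    have "cinner x y = 0" if "i \<noteq> j" "x \<in> V' i" "y \<in> V' j" for i j x y
      using that V_orthogonal[of x "k0 + i" y "k0 + j"] by (simp add: V'_def)
    then show "orthogonal_direct_sum UNIV V' K"
      unfolding orthogonal_direct_sum_def using sV' span by blast
    show "\<exists>B. finite B \<and> V' k = cvec.span B" for k
    proof -
      obtain B where "finite B" "V (k0 + k) = cvec.span B" using V_finite by blast
      then show ?thesis using subspace_of_finite_span[OF sV', of k B] by (simp add: V'_def)
    qed
    show "operator_on K D'"
      unfolding operator_on_def
    proof (intro conjI ballI allI)
      show "D' x \<in> K" if "x \<in> K" for x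
        unfolding D'_def using that sK submodule_D[OF K]
        by (simp add: cvec.subspace_diff cvec.subspace_scale)
      show "D' (x + y) = D' x + D' y" if "x \<in> K" "y \<in> K" for x y
        using D_operator that KH by (simp add: D'_def operator_on_def scaleC_add_right subset_iff)
      show "D' (c *\<^sub>C x) = c *\<^sub>C D' x" if "x \<in> K" for c x
        using D_operator that KH
        by (simp add: D'_def operator_on_def cvec.scale_right_diff_distrib scaleC_scaleC
            mult.commute subset_iff)
    qed
    show "D' x = (of_nat k / 2) *\<^sub>C x" if "x \<in> V' k" for k x
      using that D_V[of x "k0 + k"]
      by (simp add: D'_def V'_def add_divide_distrib scaleC_add_left)
    show "D' x = \<pi> (gen (Dgen 0)) x - (h + of_nat k0 / 2) *\<^sub>C x" if "x \<in> K" for x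
      using that KH D_eq[of x] by (simp add: D'_def scaleC_add_left subset_iff)
  qed
  moreover have "V' 0 \<noteq> {0}" using k0 by (simp add: V'_def)
  ultimately show ?thesis by blast
qed

section \<open>Irreducible submodules and the orthogonal decomposition\<close>

lemma positive_energy: "V 0 \<noteq> {0} \<Longrightarrow> positive_energy_rep H \<pi>"
  unfolding positive_energy_rep_def energy_decomposition_def
  using sum_V V_finite D_operator D_V D_eq unfolding gen_def by blast

lemma submodule_positive_energy:
  assumes "submodule H \<pi> K" and "K \<noteq> {0}"
  shows "positive_energy_rep K \<pi>"
  using submodule_graded[OF assms] graded_witt_rep.positive_energy by blast

text \<open>The submodule generated by a lowest vector of \<open>K\<close>, taken with respect to
  the grading of \<open>K\<close> itself.\<close>

lemma contains_irreducible:
  assumes K: "submodule H \<pi> K" "K \<noteq> {0}"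
  shows "\<exists>M. submodule H \<pi> M \<and> M \<subseteq> K \<and> irreducible_rep M \<pi>"
proof -
  obtain V' D' h' where K': "graded_witt_rep K \<pi> V' D' h'" and nz: "V' 0 \<noteq> {0}"
    using submodule_graded[OF K] by blast
  interpret K: graded_witt_rep K \<pi> V' D' h' by (rule K')
  obtain v where v: "v \<in> V' 0" "v \<noteq> 0"
    using nz cvec.subspace_0[OF K.subspace_V] by blast
  then have "v \<in> K" using K.V_subset by blast
  then have "submodule K \<pi> (generated_submodule K \<pi> v)"
    by (rule submodule_generated[OF K.action])
  then have "submodule H \<pi> (generated_submodule K \<pi> v)" "generated_submodule K \<pi> v \<subseteq> K"
    using submodule_trans[OF K(1)] by (auto simp: submodule_def)
  with K.generated_irreducible[OF v] show ?thesis by blast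
qed

text \<open>A proper subspace of a prehilbert space may have zero complement. Here \<open>S\<close>
  is graded and the energy spaces are finite-dimensional, so projections onto \<open>S\<close> exist
  degree by degree.\<close>

lemma orthogonal_complement_nonzero:
  assumes S: "submodule H \<pi> S" "S \<noteq> H"
  shows "{x \<in> H. \<forall>s\<in>S. cinner x s = 0} \<noteq> {0}"
proof
  assume zero: "{x \<in> H. \<forall>s\<in>S. cinner x s = 0} = {0}"
  have sS: "cvec.subspace S" and SH: "S \<subseteq> H" using S(1) by (simp_all add: submodule_def)
  have "V k \<subseteq> S" for k
  proof
    fix x assume x: "x \<in> V k"
    obtain B where B: "finite B" "V k = cvec.span B" using V_finite by blast
    have "cvec.subspace (S \<inter> V k)" by (intro cvec.subspace_inter sS subspace_V)
    then obtain C where C: "finite C" "S \<inter> V k = cvec.span C"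
      using subspace_of_finite_span[OF _ _ B(1)] B(2) by blast
    obtain p where p: "p \<in> S \<inter> V k" "\<And>y. y \<in> S \<inter> V k \<Longrightarrow> cinner (x - p) y = 0"
      using finite_span_projection[OF C(1), of x] C(2) by blast
    have q: "x - p \<in> V k" using x p(1) by (blast intro: cvec.subspace_diff subspace_V)
    \<comment> \<open>Components of \<open>s\<close> in other degrees are orthogonal to
      \<open>x - p\<close> by the grading, and the one in degree \<open>k\<close> by the choice of
      \<open>p\<close>.\<close>
    have "cinner (x - p) s = 0" if s: "s \<in> S" for s
    proof -
      obtain F f where F: "finite F" "\<And>j. f j \<in> V j" "\<And>j. j \<in> F \<Longrightarrow> f j \<in> S" "s = sum f F"
        using submodule_components[OF S(1) s] by blast
      have "cinner (x - p) (f j) = 0" if "j \<in> F" for j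
        using p(2) V_orthogonal[OF q F(2)] F(2,3) that by (cases "j = k") auto
      then have "s \<in> {y. cinner (x - p) y = 0}"
        unfolding F(4) by (intro cvec.subspace_sum subspace_orthogonal_right) auto
      then show ?thesis by simp
    qed
    then have "x - p = 0" using zero q V_subset by blast
    then show "x \<in> S" using p(1) by simp
  qed
  then have "H \<subseteq> S" unfolding H_span by (intro cvec.span_minimal sS) blast
  with S(2) SH show False by blast
qed

lemma span_Union_submodule:
  assumes \<K>: "\<And>K. K \<in> \<K> \<Longrightarrow> submodule H \<pi> K"
  shows "submodule H \<pi> (cvec.span (\<Union>\<K>))"
proof -
  have sub: "\<Union>\<K> \<subseteq> H" using \<K> unfolding submodule_def by blast
  have spanH: "cvec.span (\<Union>\<K>) \<subseteq> H" by (rule cvec.span_minimal[OF sub subspace_H])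
  have "\<pi> A x \<in> cvec.span (\<Union>\<K>)" if "x \<in> cvec.span (\<Union>\<K>)" for A x
  proof (rule action_span_invariant[OF sub _ that])
    show "\<pi> A x \<in> cvec.span (\<Union>\<K>)" if "x \<in> \<Union>\<K>" for x
      using that \<K> unfolding submodule_def by (blast intro: cvec.span_base)
  qed
  then show ?thesis
    unfolding submodule_def using spanH by (simp add: cvec.subspace_span)
qed

text \<open>Zorn's lemma for pairwise orthogonal families of irreducible submodules, ordered by
  inclusion.\<close>

lemma irreducible_decomposition:
  "\<exists>\<K>. orthogonal_direct_sum \<K> (\<lambda>K. K) H \<and>
     (\<forall>K\<in>\<K>. submodule H \<pi> K \<and> irreducible_rep K \<pi>)"
proof -
  define \<A> where "\<A> = {\<K>. (\<forall>K\<in>\<K>. submodule H \<pi> K \<and> irreducible_rep K \<pi>) \<and>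
     (\<forall>K\<in>\<K>. \<forall>L\<in>\<K>. K \<noteq> L \<longrightarrow> (\<forall>x\<in>K. \<forall>y\<in>L. cinner x y = 0))}"
  have "\<Union>\<C> \<in> \<A>" if chain: "subset.chain \<A> \<C>" for \<C>
  proof -
    have CA: "\<C> \<subseteq> \<A>" using chain by (simp add: subset_chain_def)
    have orth: "cinner x y = 0"
      if KL: "K \<in> \<Union>\<C>" "L \<in> \<Union>\<C>" "K \<noteq> L" and xy: "x \<in> K" "y \<in> L" for K L x y
    proof -
      \<comment> \<open>Two members of the union of a chain already lie in one family of the
        chain.\<close>
      obtain \<K> where "\<K> \<in> \<C>" "K \<in> \<K>" "L \<in> \<K>"
        using chain KL unfolding subset_chain_def by blast
      then show ?thesis using CA KL(3) xy unfolding \<A>_def by blast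
    qed
    have "submodule H \<pi> K \<and> irreducible_rep K \<pi>" if "K \<in> \<Union>\<C>" for K
      using CA that unfolding \<A>_def by blast
    moreover have "\<forall>K\<in>\<Union>\<C>. \<forall>L\<in>\<Union>\<C>. K \<noteq> L \<longrightarrow> (\<forall>x\<in>K. \<forall>y\<in>L. cinner x y = 0)"
      using orth by (intro ballI impI)
    ultimately show ?thesis unfolding \<A>_def by simp
  qed
  then have "\<exists>\<K>\<in>\<A>. \<forall>\<L>\<in>\<A>. \<K> \<subseteq> \<L> \<longrightarrow> \<L> = \<K>" by (rule subset_Zorn')
  then obtain \<K> where \<K>: "\<K> \<in> \<A>" and max: "\<And>\<L>. \<L> \<in> \<A> \<Longrightarrow> \<K> \<subseteq> \<L> \<Longrightarrow> \<L> = \<K>"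
    by blast
  define S where "S = cvec.span (\<Union>\<K>)"
  have sub: "\<And>K. K \<in> \<K> \<Longrightarrow> submodule H \<pi> K" using \<K> by (simp add: \<A>_def)
  have S: "submodule H \<pi> S" unfolding S_def by (rule span_Union_submodule[OF sub])
  have "S = H"
  proof (rule ccontr)
    assume "S \<noteq> H"
    let ?C = "{x \<in> H. \<forall>s\<in>S. cinner x s = 0}"
    have "submodule H \<pi> ?C"
      using S by (intro orthogonal_complement_submodule) (auto simp: submodule_def)
    then obtain M where M: "submodule H \<pi> M" "M \<subseteq> ?C" "irreducible_rep M \<pi>"
      using contains_irreducible[OF _ orthogonal_complement_nonzero[OF S \<open>S \<noteq> H\<close>]] by auto
    have MK: "cinner x y = 0" "cinner y x = 0" if "x \<in> M" "K \<in> \<K>" "y \<in> K" for x y K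
    proof -
      have "y \<in> S" unfolding S_def using that by (blast intro: cvec.span_base)
      then show "cinner x y = 0" using that M(2) by blast
      then show "cinner y x = 0" by (simp add: cinner_eq_0_sym)
    qed
    then have "insert M \<K> \<in> \<A>" using \<K> M(1,3) unfolding \<A>_def by simp
    \<comment> \<open>Maximality makes \<open>M\<close> a member of the family, yet \<open>M\<close>
      is orthogonal to every member, hence to itself.\<close>
    then have "M \<in> \<K>" using max[of "insert M \<K>"] by blast
    then have "cinner x x = 0" if "x \<in> M" for x using MK that by blast
    then have "M \<subseteq> {0}" by (auto simp: cinner_eq_zero_iff)
    moreover have "M \<noteq> {0}" "0 \<in> M"
      using M(1,3) by (auto simp: irreducible_rep_def submodule_def cvec.subspace_0)
    ultimately show False by blast
  qed
  then have "orthogonal_direct_sum \<K> (\<lambda>K. K) H"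
    using \<K> sub unfolding orthogonal_direct_sum_def \<A>_def S_def by (simp add: submodule_def)
  then show ?thesis using \<K> unfolding \<A>_def by blast
qed

end

theorem theorem2p11:
  fixes H :: "'h::prehilbert set" and \<pi> :: "witt \<Rightarrow> 'h \<Rightarrow> 'h"
  assumes "witt_action H \<pi>"
    and "unitary_rep H \<pi>"
    and "projective_rep H \<pi>"
    and "positive_energy_rep H \<pi>"
  shows "(\<forall>V v. energy_decomposition H \<pi> V \<and> v \<in> V 0 \<and> v \<noteq> 0 \<longrightarrow>
            submodule H \<pi> (generated_submodule H \<pi> v) \<and>
            irreducible_rep (generated_submodule H \<pi> v) \<pi>) \<and>
         (\<exists>\<K>. orthogonal_direct_sum \<K> (\<lambda>K. K) H \<and>
            (\<forall>K\<in>\<K>. submodule H \<pi> K \<and> irreducible_rep K \<pi> \<and>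
               unitary_rep K \<pi> \<and> projective_rep K \<pi> \<and> positive_energy_rep K \<pi>))"
proof -
  \<comment> \<open>The first claim concerns every energy decomposition and the second fixes one of
    them, so the passage to the locale is stated for arbitrary \<open>V\<close>.\<close>
  have graded: "\<exists>D h. graded_witt_rep H \<pi> V D h" if "energy_decomposition H \<pi> V" for V
    using that assms(1-3) unfolding energy_decomposition_def graded_witt_rep_def gen_def by blast
  have "submodule H \<pi> (generated_submodule H \<pi> v) \<and>
      irreducible_rep (generated_submodule H \<pi> v) \<pi>"
    if V: "energy_decomposition H \<pi> V" and v: "v \<in> V 0" "v \<noteq> 0" for V v
  proof -
    obtain D h where "graded_witt_rep H \<pi> V D h" using graded[OF V] by blast
    then interpret graded_witt_rep H \<pi> V D h .
    show ?thesis
      using submodule_generated[OF action] V_subset generated_irreducible[OF v] v(1) by blast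
  qed
  moreover obtain V where "energy_decomposition H \<pi> V"
    using assms(4) unfolding positive_energy_rep_def by blast
  then obtain D h where "graded_witt_rep H \<pi> V D h" using graded by blast
  then interpret graded_witt_rep H \<pi> V D h .
  obtain \<K> where \<K>: "orthogonal_direct_sum \<K> (\<lambda>K. K) H"
    "\<And>K. K \<in> \<K> \<Longrightarrow> submodule H \<pi> K \<and> irreducible_rep K \<pi>"
    using irreducible_decomposition by blast
  \<comment> \<open>Irreducible modules are nonzero by definition, so each \<open>K\<close> has a
    lowest energy and thereby positive energy.\<close>
  have "unitary_rep K \<pi> \<and> projective_rep K \<pi> \<and> positive_energy_rep K \<pi>" if "K \<in> \<K>" for K
    using \<K>(2)[OF that] submodule_unitary_rep[OF unitary] submodule_projective_rep[OF projective]
      submodule_positive_energy by (auto simp: irreducible_rep_def)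
  with \<K> have "\<exists>\<K>. orthogonal_direct_sum \<K> (\<lambda>K. K) H \<and>
            (\<forall>K\<in>\<K>. submodule H \<pi> K \<and> irreducible_rep K \<pi> \<and>
               unitary_rep K \<pi> \<and> projective_rep K \<pi> \<and> positive_energy_rep K \<pi>)"
    by blast
  ultimately show ?thesis by blast
qed

end
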